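(* Let $\mathcal K\subseteq\mathcal H$ be a nonzero collecting subspace that contains no nonzero proper subspace which is collecting. Then there exists exactly one $\rho\in\mathbf S$ with $\rho=P_{\mathcal K}\rho P_{\mathcal K}$ and $\mathcal D(\rho)=0$, and this $\rho$ satisfies $\mathrm{rank}(\rho)=\dim\mathcal K$.
   Context: Let $\mathcal H$ be a finite-dimensional complex Hilbert space, $H=H^\dagger$ and $\{h_\alpha\}$ a finite family of operators on $\mathcal H$, $\mathcal D(\rho)=-i[H,\rho]+\sum_\alpha(h_\alpha\rho h_\alpha^\dagger-\tfrac12(h_\alpha^\dagger h_\alpha\rho+\rho h_\alpha^\dagger h_\alpha))$, $\mathcal T^t=e^{t\mathcal D}$. $\mathbf S$ is the set of density matrices; $P_{\mathcal K}$ is the orthogonal projector onto $\mathcal K$. A subspace $P\mathcal H$ ($P$ an orthogonal projector) is collecting if $\mathcal T^t(P\sigma P)=P\,\mathcal T^t(P\sigma P)\,P$ for all $t>0$ and all operators $\sigma$ (in particular every enclosure, i.e. a subspace whose projector commutes with $H$ and all $h_\alpha$, is collecting). *)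

theory Defs
  imports "HOL-Analysis.Analysis"
begin

type_synonym 'n cmat = "complex^'n^'n"

definition cadj :: "'n::finite cmat \<Rightarrow> 'n cmat" where
  "cadj A = (\<chi> i j. cnj (A $ j $ i))"

definition csmult :: "complex \<Rightarrow> 'n::finite cmat \<Rightarrow> 'n cmat" where
  "csmult c A = (\<chi> i j. c * A $ i $ j)"

definition orth_proj :: "'n::finite cmat \<Rightarrow> bool" where
  "orth_proj P \<longleftrightarrow> P ** P = P \<and> cadj P = P"

definition psd :: "'n::finite cmat \<Rightarrow> bool" where
  "psd A \<longleftrightarrow> cadj A = A \<and>
     (\<forall>v::complex^'n. 0 \<le> Re (\<Sum>i\<in>UNIV. cnj (v $ i) * (A *v v) $ i))"

definition density :: "'n::finite cmat \<Rightarrow> bool" where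
  "density \<rho> \<longleftrightarrow> psd \<rho> \<and> trace \<rho> = 1"

definition lindblad :: "'n::finite cmat \<Rightarrow> 'a set \<Rightarrow> ('a \<Rightarrow> 'n cmat) \<Rightarrow> 'n cmat \<Rightarrow> 'n cmat" where
  "lindblad H I h \<rho> =
     csmult (- \<i>) (H ** \<rho> - \<rho> ** H)
     + (\<Sum>a\<in>I. h a ** \<rho> ** cadj (h a)
          - csmult (1/2) (cadj (h a) ** h a ** \<rho> + \<rho> ** cadj (h a) ** h a))"

definition semigroup :: "('n::finite cmat \<Rightarrow> 'n cmat) \<Rightarrow> real \<Rightarrow> 'n cmat \<Rightarrow> 'n cmat" where
  "semigroup D t \<sigma> = (\<Sum>k. (t ^ k / fact k) *\<^sub>R (D ^^ k) \<sigma>)"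

definition collecting :: "'n::finite cmat \<Rightarrow> 'a set \<Rightarrow> ('a \<Rightarrow> 'n cmat) \<Rightarrow> 'n cmat \<Rightarrow> bool" where
  "collecting H I h P \<longleftrightarrow> orth_proj P \<and>
     (\<forall>t>0. \<forall>\<sigma>. semigroup (lindblad H I h) t (P ** \<sigma> ** P)
                 = P ** semigroup (lindblad H I h) t (P ** \<sigma> ** P) ** P)"

definition rng :: "'n::finite cmat \<Rightarrow> (complex^'n) set" where
  "rng P = range (\<lambda>v. P *v v)"

end

(* A projector P is collecting iff the generator D preserves the corner of matrices P X P.
   On this corner D has traceless values, so it is not onto and kills some nonzero Hermitian T.
   Split T = p - m into its positive and negative parts. Comparing traces of the blocks of
   D p = D m shows, without exponentiating D, that the support of p is itself collecting. By
   minimality of P, either T or -T is therefore positive with support exactly P. Normalising T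
   gives the faithful stationary state; the difference of two such states is a Hermitian
   stationary matrix of trace 0, hence zero. *)
theory Submission
  imports Defs
begin

section \<open>Complex matrices\<close>

text \<open>The obstacle is to extract an invariant subspace from the single equation
  \<open>D \<tau> = 0\<close> with \<tau> indefinite. The generator is rewritten as G X + X
  \<open>cadj G\<close> plus the sum of the terms h X \<open>cadj h\<close>, where G absorbs the
  Hamiltonian and the anticommutator. If Q projects onto the support of p and N = 1 - Q, the G terms
  vanish in N (D p) N and in Q (D m) Q, so these blocks are sums of positive terms. Their traces add
  up to the trace of the common value D p = D m, which is 0, so every term vanishes. This settles
  the operators h. For G the off-diagonal block leaves m X + X p = 0 with X = N G Q, and multiplying
  by the adjoint of X makes both traces nonnegative. Full support is carried as a cancellation rule,
  \<open>Y ** \<tau> = 0\<close> implies \<open>Y ** P = 0\<close>, because that form applies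
  directly to blocks of operators; it becomes a statement about ranges only when the rank is
  computed.\<close>

lemma matrix_add_rdistrib: "(A + B) ** C = A ** C + B ** C" for A B C :: "'n::finite cmat"
  by (simp add: vec_eq_iff matrix_matrix_mult_def sum.distrib algebra_simps)

lemma matrix_diff_ldistrib: "A ** (B - C) = A ** B - A ** C" for A B C :: "'n::finite cmat"
  by (simp add: vec_eq_iff matrix_matrix_mult_def sum_subtractf algebra_simps)

lemma matrix_diff_rdistrib: "(A - B) ** C = A ** C - B ** C" for A B C :: "'n::finite cmat"
  by (simp add: vec_eq_iff matrix_matrix_mult_def sum_subtractf algebra_simps)

lemma matrix_minus_left: "(- A) ** B = - (A ** B)" for A B :: "'n::finite cmat"
  by (simp add: vec_eq_iff matrix_matrix_mult_def sum_negf)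

lemma matrix_minus_right: "A ** (- B) = - (A ** B)" for A B :: "'n::finite cmat"
  by (simp add: vec_eq_iff matrix_matrix_mult_def sum_negf)

lemma matrix_sum_left: "(\<Sum>a\<in>I. f a) ** B = (\<Sum>a\<in>I. f a ** B)"
  for f :: "'a \<Rightarrow> 'n::finite cmat" and B :: "'n cmat"
  by (induction I rule: infinite_finite_induct) (auto simp: matrix_add_rdistrib)

lemma matrix_sum_right: "B ** (\<Sum>a\<in>I. f a) = (\<Sum>a\<in>I. B ** f a)"
  for f :: "'a \<Rightarrow> 'n::finite cmat" and B :: "'n cmat"
  by (induction I rule: infinite_finite_induct) (auto simp: matrix_add_ldistrib)

lemma matrix_scaleR_left: "(r *\<^sub>R A) ** B = r *\<^sub>R (A ** B)" for A B :: "'n::finite cmat"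
  by (simp add: scalar_matrix_assoc)

lemma matrix_scaleR_right: "A ** (r *\<^sub>R B) = r *\<^sub>R (A ** B)" for A B :: "'n::finite cmat"
  by (simp add: vec_eq_iff matrix_matrix_mult_def scaleR_sum_right)

lemma csmult_left: "csmult c A ** B = csmult c (A ** B)" for A B :: "'n::finite cmat"
  by (simp add: vec_eq_iff matrix_matrix_mult_def csmult_def sum_distrib_left mult.assoc)

lemma csmult_right: "A ** csmult c B = csmult c (A ** B)" for A B :: "'n::finite cmat"
  by (simp add: vec_eq_iff matrix_matrix_mult_def csmult_def sum_distrib_left mult.left_commute)

lemma csmult_add: "csmult c (A + B) = csmult c A + csmult c B"
  by (simp add: vec_eq_iff csmult_def algebra_simps)

lemma csmult_diff: "csmult c (A - B) = csmult c A - csmult c B"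
  by (simp add: vec_eq_iff csmult_def algebra_simps)

lemma csmult_sum: "csmult c (\<Sum>a\<in>I. f a) = (\<Sum>a\<in>I. csmult c (f a))"
  by (simp add: vec_eq_iff csmult_def sum_distrib_left)

lemmas matrix_distribs = matrix_add_ldistrib matrix_add_rdistrib matrix_diff_ldistrib
  matrix_diff_rdistrib matrix_minus_left matrix_minus_right matrix_sum_left matrix_sum_right
  matrix_scaleR_left matrix_scaleR_right csmult_left csmult_right

lemma scaleR_matrix_vector: "(r *\<^sub>R A) *v x = r *\<^sub>R (A *v x)" for A :: "'n::finite cmat"
  by (simp add: vec_eq_iff matrix_vector_mult_def scaleR_sum_right)

lemma matrix_vector_scaleR: "A *v (r *\<^sub>R x) = r *\<^sub>R (A *v x)" for A :: "'n::finite cmat"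
  by (simp add: vec_eq_iff matrix_vector_mult_def scaleR_sum_right)

lemma minus_matrix_vector: "(- A) *v x = - (A *v x)" for A :: "'n::finite cmat"
  by (simp add: vec_eq_iff matrix_vector_mult_def sum_negf)

lemma cadj_cadj [simp]: "cadj (cadj A) = A"
  by (simp add: vec_eq_iff cadj_def)

lemma cadj_0 [simp]: "cadj 0 = 0"
  by (simp add: vec_eq_iff cadj_def)

lemma cadj_mat_1 [simp]: "cadj (mat 1) = mat 1"
  by (simp add: vec_eq_iff cadj_def mat_def)

lemma cadj_mult: "cadj (A ** B) = cadj B ** cadj A"
  by (simp add: vec_eq_iff cadj_def matrix_matrix_mult_def mult.commute)

lemma cadj_add: "cadj (A + B) = cadj A + cadj B"
  by (simp add: vec_eq_iff cadj_def)

lemma cadj_diff: "cadj (A - B) = cadj A - cadj B"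
  by (simp add: vec_eq_iff cadj_def)

lemma cadj_minus: "cadj (- A) = - cadj A"
  by (simp add: vec_eq_iff cadj_def)

lemma cadj_scaleR: "cadj (r *\<^sub>R A) = r *\<^sub>R cadj A"
  by (simp add: vec_eq_iff cadj_def complex_eq_iff)

lemma cadj_csmult: "cadj (csmult c A) = csmult (cnj c) (cadj A)"
  by (simp add: vec_eq_iff cadj_def csmult_def)

lemma cadj_sum: "cadj (\<Sum>a\<in>I. f a) = (\<Sum>a\<in>I. cadj (f a))"
  by (simp add: vec_eq_iff cadj_def)

lemmas cadj_simps = cadj_mult cadj_add cadj_diff cadj_minus cadj_scaleR cadj_csmult cadj_sum

lemma trace_scaleR: "trace (r *\<^sub>R A) = r *\<^sub>R trace A" for A :: "'n::finite cmat"
  by (simp add: trace_def scaleR_sum_right)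

lemma trace_sum: "trace (\<Sum>a\<in>I. f a) = (\<Sum>a\<in>I. trace (f a))"
  for f :: "'a \<Rightarrow> 'n::finite cmat"
  unfolding trace_def sum_component by (rule sum.swap)

lemma trace_hermitian: "cadj A = A \<Longrightarrow> trace A = of_real (Re (trace A))"
proof -
  assume "cadj A = A"
  then have "cnj (A $ i $ i) = A $ i $ i" for i
    by (metis (no_types, lifting) cadj_def vec_lambda_beta)
  then have "cnj (trace A) = trace A"
    by (simp add: trace_def)
  then show ?thesis
    by (metis Reals_cnj_iff of_real_Re)
qed

section \<open>Real inner product and positive semidefinite matrices\<close>

lemma inner_complex_vec: "v \<bullet> w = Re (\<Sum>i\<in>UNIV. cnj (v $ i) * w $ i)" for v w :: "complex^'n"
  by (simp add: inner_vec_def inner_complex_def)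

text \<open>Taking real parts in the Hermitian adjoint identity gives this one. For Hermitian
  matrices the quadratic form is real, so the real inner product loses nothing.\<close>

lemma inner_matrix_vector: "v \<bullet> (A *v w) = (cadj A *v v) \<bullet> w" for A :: "'n::finite cmat"
proof -
  have "(\<Sum>i\<in>UNIV. cnj (v $ i) * (A *v w) $ i) = (\<Sum>i\<in>UNIV. cnj ((cadj A *v v) $ i) * w $ i)"
    unfolding matrix_vector_mult_def cadj_def
    by (simp add: sum_distrib_left sum_distrib_right mult_ac)
      (rule sum.swap)
  then show ?thesis
    by (simp only: inner_complex_vec)
qed

lemma psd_iff: "psd A \<longleftrightarrow> cadj A = A \<and> (\<forall>v. 0 \<le> v \<bullet> (A *v v))"
  by (simp add: psd_def inner_complex_vec)

text \<open>Moving from \<open>w\<close> in the direction \<open>- (A *v w)\<close> changes the form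
  at first order by -2 times the squared norm of \<open>A *v w\<close>; starting from 0 it would
  become negative unless that vector is 0.\<close>

lemma psd_null_vector:
  assumes "psd A" "w \<bullet> (A *v w) = 0"
  shows "A *v w = 0"
proof (rule ccontr)
  define u where "u = A *v w"
  define c where "c = u \<bullet> (A *v u)"
  assume "A *v w \<noteq> 0"
  then have u: "u \<bullet> u > 0"
    by (simp add: u_def)
  have A: "cadj A = A" "\<And>v. 0 \<le> v \<bullet> (A *v v)"
    using assms by (auto simp: psd_iff)
  have "w \<bullet> (A *v u) = u \<bullet> u"
    by (simp add: inner_matrix_vector A u_def)
  then have "(w - t *\<^sub>R u) \<bullet> (A *v (w - t *\<^sub>R u)) = t * (t * c - 2 * (u \<bullet> u))" for t
    using assms(2)
    by (simp add: algebra_simps matrix_vector_scaleR inner_commute[of u w] flip: u_def)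
      (simp add: c_def)
  then have *: "0 \<le> t * (t * c - 2 * (u \<bullet> u))" for t
    using A(2) by metis
  have c: "c \<ge> 0"
    using A by (simp add: c_def)
  \<comment> \<open>The summand 1 keeps the denominator positive when \<open>c = 0\<close>, while
    \<open>t * c\<close> stays below \<open>u \<bullet> u\<close>.\<close>
  define t where "t = (u \<bullet> u) / (c + 1)"
  have "t > 0" "t * c < 2 * (u \<bullet> u)"
    using u c by (auto simp: t_def field_simps intro!: add_nonneg_pos)
  then show False
    using *[of t] by (simp add: zero_le_mult_iff)
qed

lemma matrix_eq_0_iff: "A = 0 \<longleftrightarrow> (\<forall>v. A *v v = 0)" for A :: "'n::finite cmat"
  by (simp add: matrix_eq)

lemma matrix_vector_axis: "(A *v axis j 1) $ i = A $ i $ j" for A :: "'n::finite cmat"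
  by (simp add: matrix_vector_mult_def axis_def if_distrib cong: if_cong)

lemma axis_matrix_vector: "axis i 1 \<bullet> (A *v axis i 1) = Re (A $ i $ i)" for A :: "'n::finite cmat"
  by (simp add: inner_axis' matrix_vector_axis inner_complex_def)

lemma psd_trace_nonneg: "psd A \<Longrightarrow> 0 \<le> Re (trace A)"
  unfolding trace_def Re_sum by (intro sum_nonneg) (metis axis_matrix_vector psd_iff)

lemma psd_trace_eq_0:
  assumes "psd A" "Re (trace A) = 0"
  shows "A = 0"
proof -
  have nonneg: "0 \<le> Re (A $ i $ i)" for i
    using assms(1) by (metis axis_matrix_vector psd_iff)
  have "Re (A $ i $ i) = 0" for i
    using assms(2) nonneg unfolding trace_def Re_sum by (simp add: sum_nonneg_eq_0_iff)
  then have "A *v axis i 1 = 0" for i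
    by (intro psd_null_vector assms(1)) (simp add: axis_matrix_vector)
  then show ?thesis
    by (metis (no_types, lifting) matrix_vector_axis vec_eq_iff zero_index)
qed

lemma psd_congruence: "psd A \<Longrightarrow> psd (X ** A ** cadj X)"
proof -
  assume "psd A"
  moreover have "v \<bullet> ((X ** A ** cadj X) *v v) = (cadj X *v v) \<bullet> (A *v (cadj X *v v))" for v
    by (metis inner_matrix_vector matrix_vector_mul_assoc)
  ultimately show ?thesis
    by (simp add: psd_iff cadj_simps matrix_mul_assoc)
qed

text \<open>The form of \<open>A\<close> vanishes on the range of \<open>cadj X\<close>, so
  \<open>A\<close> kills that range; the adjoint of this fact is the claim.\<close>

lemma psd_congruence_eq_0:
  assumes "psd A" "X ** A ** cadj X = 0"
  shows "X ** A = 0"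
proof -
  have "A *v (cadj X *v v) = 0" for v
  proof (rule psd_null_vector[OF assms(1)])
    show "(cadj X *v v) \<bullet> (A *v (cadj X *v v)) = 0"
      by (metis assms(2) inner_matrix_vector inner_zero_right matrix_vector_mul_assoc matrix_vector_mult_0)
  qed
  then have "A ** cadj X = 0"
    by (simp add: matrix_eq_0_iff matrix_vector_mul_assoc)
  then have "cadj (A ** cadj X) = 0"
    by simp
  then show ?thesis
    using assms(1) by (simp add: cadj_simps psd_iff)
qed

lemma trace_cadj_mult_self: "Re (trace (cadj X ** X)) = X \<bullet> X"
  unfolding trace_def matrix_matrix_mult_def cadj_def inner_vec_def inner_complex_def
  by simp (rule sum.swap)

section \<open>The positive part of a Hermitian matrix\<close>

definition outer :: "complex^'n::finite \<Rightarrow> 'n cmat" where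
  "outer w = (\<chi> i j. w $ i * cnj (w $ j))"

lemma cadj_outer [simp]: "cadj (outer w) = outer w"
  by (simp add: vec_eq_iff cadj_def outer_def)

lemma matrix_outer: "A ** outer w = (\<chi> i j. (A *v w) $ i * cnj (w $ j))"
  by (simp add: vec_eq_iff outer_def matrix_matrix_mult_def matrix_vector_mult_def
      sum_distrib_right mult.assoc)

lemma outer_self:
  assumes "norm w = 1"
  shows "outer w *v w = w"
proof -
  have "(\<Sum>j\<in>UNIV. cnj (w $ j) * w $ j) = of_real (w \<bullet> w)"
    by (simp add: inner_vec_def inner_complex_def complex_eq_iff mult.commute)
  then have "(\<Sum>j\<in>UNIV. cnj (w $ j) * w $ j) = 1"
    using assms by (simp add: dot_square_norm)
  then show ?thesis
    by (simp add: vec_eq_iff outer_def matrix_vector_mult_def mult.assoc flip: sum_distrib_left)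
qed

lemma outer_idem: "norm w = 1 \<Longrightarrow> outer w ** outer w = outer w"
  unfolding matrix_outer outer_self by (simp add: outer_def outer_self)

lemma orth_projD: "orth_proj P \<Longrightarrow> P ** P = P" "orth_proj P \<Longrightarrow> cadj P = P"
  by (simp_all add: orth_proj_def)

lemma rng_orth_proj: "orth_proj P \<Longrightarrow> v \<in> rng P \<longleftrightarrow> P *v v = v"
proof
  assume "orth_proj P" "v \<in> rng P"
  then show "P *v v = v"
    by (auto simp: rng_def matrix_vector_mul_assoc orth_proj_def)
next
  assume "P *v v = v"
  then show "v \<in> rng P"
    unfolding rng_def by (metis rangeI)
qed

lemma orth_proj_compl: "orth_proj P \<Longrightarrow> orth_proj (mat 1 - P)"
  by (simp add: orth_proj_def matrix_distribs cadj_simps)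

text \<open>Maximality makes the compression of \<mu> - \<tau> to the kernel of \<open>Q\<close>
  positive semidefinite, and the form of this compression vanishes at \<open>w\<close>;
  \<open>psd_null_vector\<close> then yields the eigenvalue equation.\<close>

lemma Rayleigh_maximizer_eigenvector:
  fixes \<tau> Q :: "'n::finite cmat"
  assumes herm: "cadj \<tau> = \<tau>" and Q: "orth_proj Q" and comm: "Q ** \<tau> = \<tau> ** Q"
    and w: "Q *v w = 0" "norm w = 1"
    and max: "\<And>v. Q *v v = 0 \<Longrightarrow> norm v = 1 \<Longrightarrow> v \<bullet> (\<tau> *v v) \<le> w \<bullet> (\<tau> *v w)"
  shows "\<tau> *v w = (w \<bullet> (\<tau> *v w)) *\<^sub>R w"
proof -
  define \<mu> where "\<mu> = w \<bullet> (\<tau> *v w)"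
  define R where "R = mat 1 - Q"
  have R: "R ** R = R" "cadj R = R"
    using orth_proj_compl[OF Q] by (simp_all add: R_def orth_proj_def)
  have QR: "Q ** R = 0"
    using Q by (simp add: R_def matrix_distribs orth_proj_def)
  have Rw: "R *v w = w"
    using w by (simp add: R_def matrix_vector_mult_diff_rdistrib)
  have Rtau: "R ** \<tau> = \<tau> ** R"
    using comm by (simp add: R_def matrix_distribs)
  have le: "v \<bullet> (\<tau> *v v) \<le> \<mu> * (v \<bullet> v)" if "Q *v v = 0" for v
  proof (cases "v = 0")
    case False
    define u where "u = (1 / norm v) *\<^sub>R v"
    have "u \<bullet> (\<tau> *v u) \<le> \<mu>"
      unfolding \<mu>_def using that False
      by (intro max) (simp_all add: u_def matrix_vector_scaleR)
    moreover have "u \<bullet> (\<tau> *v u) = (v \<bullet> (\<tau> *v v)) / (v \<bullet> v)"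
      by (simp add: u_def matrix_vector_scaleR dot_square_norm power2_eq_square)
    ultimately show ?thesis
      using False by (simp add: divide_le_eq)
  qed auto
  define A where "A = \<mu> *\<^sub>R R - R ** \<tau> ** R"
  have form: "x \<bullet> (A *v x) = \<mu> * ((R *v x) \<bullet> (R *v x)) - (R *v x) \<bullet> (\<tau> *v (R *v x))" for x
  proof -
    have "(R *v x) \<bullet> (R *v x) = x \<bullet> (R *v x)"
      by (metis R inner_matrix_vector matrix_vector_mul_assoc)
    moreover have "(R *v x) \<bullet> (\<tau> *v (R *v x)) = x \<bullet> ((R ** \<tau> ** R) *v x)"
      by (metis R inner_matrix_vector matrix_vector_mul_assoc)
    ultimately show ?thesis
      by (simp add: A_def matrix_vector_mult_diff_rdistrib scaleR_matrix_vector inner_diff_right)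
  qed
  have "psd A"
    unfolding psd_iff
  proof (intro conjI allI)
    show "cadj A = A"
      by (simp add: A_def cadj_simps R herm matrix_mul_assoc)
    show "0 \<le> x \<bullet> (A *v x)" for x
      using le[of "R *v x"] by (simp add: form matrix_vector_mul_assoc QR)
  qed
  moreover have "w \<bullet> (A *v w) = 0"
    using w by (simp add: form Rw \<mu>_def dot_square_norm)
  ultimately have "A *v w = 0"
    by (rule psd_null_vector)
  moreover have "(R ** \<tau> ** R) *v w = \<tau> *v w"
    by (metis R(1) Rtau Rw matrix_mul_assoc matrix_vector_mul_assoc)
  ultimately show ?thesis
    by (simp add: A_def matrix_vector_mult_diff_rdistrib scaleR_matrix_vector Rw \<mu>_def)
qed

text \<open>Only the range is constrained. The class contains 0 and is closed under adjoining an
  eigenvector from the kernel with positive eigenvalue, so its largest members are the positive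
  spectral projectors proper.\<close>

definition positive_spectral_proj :: "'n::finite cmat \<Rightarrow> 'n cmat \<Rightarrow> bool" where
  "positive_spectral_proj \<tau> Q \<longleftrightarrow> orth_proj Q \<and> Q ** \<tau> = \<tau> ** Q \<and>
     (\<forall>v. Q *v v = v \<and> v \<noteq> 0 \<longrightarrow> 0 < v \<bullet> (\<tau> *v v))"

text \<open>The matrix \<tau> commutes with the mutually orthogonal projectors \<open>Q\<close> and
  \<open>outer w\<close>, so the cross terms vanish and the form on the enlarged range is the sum of
  the two separate forms.\<close>

lemma positive_spectral_proj_extend:
  fixes \<tau> Q :: "'n::finite cmat"
  assumes herm: "cadj \<tau> = \<tau>" and Q: "positive_spectral_proj \<tau> Q"
    and w: "Q *v w = 0" "norm w = 1" and eig: "\<tau> *v w = \<mu> *\<^sub>R w" "\<mu> > 0"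
  shows "positive_spectral_proj \<tau> (Q + outer w)" and "rng Q \<subset> rng (Q + outer w)"
proof -
  have Q': "Q ** Q = Q" "cadj Q = Q" "Q ** \<tau> = \<tau> ** Q"
    using Q by (auto simp: positive_spectral_proj_def orth_proj_def)
  have Qo: "Q ** outer w = 0"
    by (simp add: matrix_outer w vec_eq_iff)
  then have "cadj (Q ** outer w) = 0"
    by simp
  then have oQ: "outer w ** Q = 0"
    by (simp add: cadj_simps Q')
  have to: "\<tau> ** outer w = \<mu> *\<^sub>R outer w"
    by (simp add: matrix_outer eig) (simp add: vec_eq_iff outer_def)
  then have "cadj (\<tau> ** outer w) = \<mu> *\<^sub>R outer w"
    by (simp add: cadj_simps)
  then have ot: "outer w ** \<tau> = \<mu> *\<^sub>R outer w"
    by (simp add: cadj_simps herm)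
  have proj: "orth_proj (Q + outer w)"
    by (simp add: orth_proj_def matrix_distribs cadj_simps Q' Qo oQ outer_idem w)
  have pos: "0 < v \<bullet> (\<tau> *v v)" if v: "(Q + outer w) *v v = v" "v \<noteq> 0" for v
  proof -
    define a b where "a = Q *v v" and "b = outer w *v v"
    have vab: "v = a + b"
      using v by (simp add: a_def b_def matrix_vector_mult_add_rdistrib)
    have ab: "a \<bullet> b = 0"
      unfolding a_def b_def
      by (metis Q'(2) Qo inner_matrix_vector inner_zero_right matrix_vector_mul_assoc matrix_vector_mult_0)
    have tb: "\<tau> *v b = \<mu> *\<^sub>R b"
      by (simp add: b_def matrix_vector_mul_assoc to scaleR_matrix_vector)
    have "b \<bullet> (\<tau> *v a) = \<mu> * (b \<bullet> a)"
      by (simp add: inner_matrix_vector[of b] herm tb)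
    then have *: "v \<bullet> (\<tau> *v v) = a \<bullet> (\<tau> *v a) + \<mu> * (b \<bullet> b)"
      using ab by (simp add: vab matrix_vector_right_distrib inner_add_left inner_add_right tb inner_commute)
    have "Q *v a = a"
      by (simp add: a_def matrix_vector_mul_assoc Q')
    then have "a \<noteq> 0 \<Longrightarrow> 0 < a \<bullet> (\<tau> *v a)"
      using Q by (simp add: positive_spectral_proj_def)
    moreover have "a \<noteq> 0 \<or> b \<noteq> 0"
      using v vab by auto
    ultimately show ?thesis
      using eig(2) unfolding *
      by (cases "a = 0"; cases "b = 0") (auto intro!: add_pos_nonneg)
  qed
  show "positive_spectral_proj \<tau> (Q + outer w)"
    using proj pos by (simp add: positive_spectral_proj_def matrix_distribs Q' to ot)
  have orthQ: "orth_proj Q"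
    by (simp add: orth_proj_def Q')
  have "(Q + outer w) *v v = v" if "Q *v v = v" for v
  proof -
    have "(Q + outer w) *v (Q *v v) = Q *v v"
      by (simp only: matrix_vector_mul_assoc matrix_add_rdistrib Q' oQ add_0_right)
    then show ?thesis
      using that by simp
  qed
  then have "rng Q \<subseteq> rng (Q + outer w)"
    by (auto simp: rng_orth_proj proj orthQ)
  moreover have "w \<in> rng (Q + outer w)"
    by (simp add: rng_orth_proj proj matrix_vector_mult_add_rdistrib w outer_self)
  moreover have "w \<notin> rng Q"
    using w by (auto simp: rng_orth_proj orthQ)
  ultimately show "rng Q \<subset> rng (Q + outer w)"
    by blast
qed

lemma span_rng: "span (rng A) = rng A"
  unfolding rng_def
  by (simp add: linear_subspace_image)

text \<open>A projector of largest rank works: were the form positive somewhere on its kernel, a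
  maximizer over the compact unit sphere of the kernel would be an eigenvector that could be
  adjoined.\<close>

lemma spectral_split:
  fixes \<tau> :: "'n::finite cmat"
  assumes herm: "cadj \<tau> = \<tau>"
  obtains Q where "positive_spectral_proj \<tau> Q" "\<And>v. Q *v v = 0 \<Longrightarrow> v \<bullet> (\<tau> *v v) \<le> 0"
proof -
  have "positive_spectral_proj \<tau> 0"
    by (simp add: positive_spectral_proj_def orth_proj_def)
  \<comment> \<open>\<open>dim\<close> counts real dimension here, hence the bound by
    \<open>DIM(complex^'n)\<close>.\<close>
  moreover have "\<forall>Q. positive_spectral_proj \<tau> Q \<longrightarrow> dim (rng Q) < Suc DIM(complex^'n)"
    by (simp only: dim_subset_UNIV simp_thms less_Suc_eq_le)
  ultimately obtain Q where Q: "positive_spectral_proj \<tau> Q"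
    and Qmax: "\<And>Q'. positive_spectral_proj \<tau> Q' \<Longrightarrow> dim (rng Q') \<le> dim (rng Q)"
    using ex_has_greatest_nat[of "positive_spectral_proj \<tau>" 0 "\<lambda>Q. dim (rng Q)"] by metis
  have orthQ: "orth_proj Q" "Q ** \<tau> = \<tau> ** Q"
    using Q by (auto simp: positive_spectral_proj_def)
  have "v \<bullet> (\<tau> *v v) \<le> 0" if v: "Q *v v = 0" for v
  proof (rule ccontr)
    assume pos: "\<not> v \<bullet> (\<tau> *v v) \<le> 0"
    then have "v \<noteq> 0"
      by auto
    define u where "u = (1 / norm v) *\<^sub>R v"
    define S where "S = {v. Q *v v = 0} \<inter> sphere 0 1"
    have u: "u \<in> S" "0 < u \<bullet> (\<tau> *v u)"
      using v pos \<open>v \<noteq> 0\<close> by (auto simp: S_def u_def matrix_vector_scaleR zero_less_mult_iff zero_less_divide_iff)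
    have "closed {v. Q *v v = 0}"
      by (intro closed_Collect_eq continuous_intros matrix_vector_mult_linear_continuous_on)
    then have "compact S"
      unfolding S_def by (intro closed_Int_compact) auto
    moreover have "continuous_on S (\<lambda>v. v \<bullet> (\<tau> *v v))"
      by (intro continuous_intros matrix_vector_mult_linear_continuous_on)
    ultimately obtain w where w: "w \<in> S" "\<And>v. v \<in> S \<Longrightarrow> v \<bullet> (\<tau> *v v) \<le> w \<bullet> (\<tau> *v w)"
      using u continuous_attains_sup[of S "\<lambda>v. v \<bullet> (\<tau> *v v)"] by blast
    have w': "Q *v w = 0" "norm w = 1"
      using w by (auto simp: S_def)
    have eig: "\<tau> *v w = (w \<bullet> (\<tau> *v w)) *\<^sub>R w"
      using w by (intro Rayleigh_maximizer_eigenvector[OF herm orthQ w']) (auto simp: S_def)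
    have "0 < w \<bullet> (\<tau> *v w)"
      using w u by (meson less_le_trans)
    note ext = positive_spectral_proj_extend[OF herm Q w' eig this]
    have "dim (rng Q) < dim (rng (Q + outer w))"
      using ext(2) by (intro dim_psubset) (simp add: span_rng)
    then show False
      using Qmax[OF ext(1)] by simp
  qed
  with Q show thesis
    using that by blast
qed

section \<open>Algebra of the generator\<close>

definition gksl :: "'n::finite cmat \<Rightarrow> 'a set \<Rightarrow> ('a \<Rightarrow> 'n cmat) \<Rightarrow> 'n cmat \<Rightarrow> 'n cmat" where
  "gksl G I h X = G ** X + X ** cadj G + (\<Sum>a\<in>I. h a ** X ** cadj (h a))"

text \<open>This is -i times the effective non-Hermitian Hamiltonian.\<close>

definition drift :: "'n::finite cmat \<Rightarrow> 'a set \<Rightarrow> ('a \<Rightarrow> 'n cmat) \<Rightarrow> 'n cmat" where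
  "drift H I h = csmult (- \<i>) H - csmult (1/2) (\<Sum>a\<in>I. cadj (h a) ** h a)"

text \<open>Equivalently, the adjoint generator kills the identity, which is trace preservation
  expressed through \<open>G\<close> and \<open>h\<close>.\<close>

definition conservative :: "'n::finite cmat \<Rightarrow> 'a set \<Rightarrow> ('a \<Rightarrow> 'n cmat) \<Rightarrow> bool" where
  "conservative G I h \<longleftrightarrow> G + cadj G + (\<Sum>a\<in>I. cadj (h a) ** h a) = 0"

lemma conservative_drift: "cadj H = H \<Longrightarrow> conservative (drift H I h) I h"
  by (simp add: conservative_def drift_def cadj_simps) (simp add: vec_eq_iff csmult_def)

lemma lindblad_eq_gksl: "cadj H = H \<Longrightarrow> lindblad H I h = gksl (drift H I h) I h"
  by (rule ext) (simp add: lindblad_def gksl_def drift_def cadj_simps matrix_distribs sum.distrib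
      sum_subtractf csmult_sum csmult_add csmult_diff matrix_mul_assoc,
      simp add: vec_eq_iff csmult_def)

lemma trace_gksl:
  assumes "conservative G I h"
  shows "trace (gksl G I h X) = 0"
proof -
  have "trace (gksl G I h X) = trace ((G + cadj G + (\<Sum>a\<in>I. cadj (h a) ** h a)) ** X)"
    by (simp add: gksl_def matrix_distribs trace_add trace_sum trace_mul_sym[of X]
        trace_mul_sym[of "_ ** X"] matrix_mul_assoc)
  then show ?thesis
    using assms by (simp add: conservative_def trace_def)
qed

lemma cadj_gksl: "cadj (gksl G I h X) = gksl G I h (cadj X)"
  by (simp add: gksl_def cadj_simps matrix_mul_assoc add.commute)

lemma gksl_csmult: "gksl G I h (csmult c X) = csmult c (gksl G I h X)"
  by (simp add: gksl_def matrix_distribs csmult_add csmult_sum)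

lemma gksl_add: "gksl G I h (X + Y) = gksl G I h X + gksl G I h Y"
  by (simp add: gksl_def matrix_distribs sum.distrib)

lemma gksl_scaleR: "gksl G I h (r *\<^sub>R X) = r *\<^sub>R gksl G I h X"
  by (simp add: gksl_def matrix_distribs scaleR_right_distrib scaleR_sum_right)

lemma linear_gksl: "linear (gksl G I h)"
  by (intro linearI gksl_add gksl_scaleR)

section \<open>Invariance of the support of the positive part\<close>

lemma psd_term_trace_zero:
  assumes "finite I" "\<And>a. a \<in> I \<Longrightarrow> psd (f a)" "\<And>a. a \<in> I \<Longrightarrow> psd (g a)"
    and "trace ((\<Sum>a\<in>I. f a) + (\<Sum>a\<in>I. g a)) = 0" "a \<in> I"
  shows "f a = 0" "g a = 0"
proof -
  have nn: "0 \<le> Re (trace (f a))" "0 \<le> Re (trace (g a))" if "a \<in> I" for a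
    using that assms by (auto intro: psd_trace_nonneg)
  have "(\<Sum>a\<in>I. Re (trace (f a)) + Re (trace (g a))) = Re (trace ((\<Sum>a\<in>I. f a) + (\<Sum>a\<in>I. g a)))"
    by (simp add: trace_add trace_sum sum.distrib)
  also have "\<dots> = 0"
    using assms by simp
  finally have "Re (trace (f a)) + Re (trace (g a)) = 0"
    using sum_nonneg_eq_0_iff[of I "\<lambda>a. Re (trace (f a)) + Re (trace (g a))"] nn assms by auto
  then have "Re (trace (f a)) = 0" "Re (trace (g a)) = 0"
    using nn[OF assms(5)] by auto
  then show "f a = 0" "g a = 0"
    using assms psd_trace_eq_0 by blast+
qed

text \<open>The first two conclusions make the range of \<open>Q\<close> invariant under every
  \<open>h a\<close> and under \<open>G\<close>, as \<open>corner_invariantI\<close> requires. The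
  last one says that \<open>Q\<close> is no larger than the support of
  \<open>\<tau> ** Q\<close>.\<close>

lemma positive_support_invariant:
  fixes \<tau> Q :: "'n::finite cmat"
  assumes fin: "finite I" and cons: "conservative G I h"
    and herm: "cadj \<tau> = \<tau>" and stat: "gksl G I h \<tau> = 0"
    and Q: "positive_spectral_proj \<tau> Q" and neg: "\<And>v. Q *v v = 0 \<Longrightarrow> v \<bullet> (\<tau> *v v) \<le> 0"
  defines "N \<equiv> mat 1 - Q"
  shows "a \<in> I \<Longrightarrow> N ** h a ** Q = 0" and "N ** G ** Q = 0"
    and "psd (\<tau> ** Q)" and "\<And>Y :: 'n cmat. Y ** (\<tau> ** Q) = 0 \<Longrightarrow> Y ** Q = 0"
proof -
  define p m where "p = \<tau> ** Q" and "m = - (\<tau> ** N)"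
  have QQ: "Q ** Q = Q" "cadj Q = Q" and comm: "Q ** \<tau> = \<tau> ** Q"
    using Q by (auto simp: positive_spectral_proj_def orth_proj_def)
  have NN: "N ** N = N" "cadj N = N" "N ** Q = 0" "Q ** N = 0" "N ** \<tau> = \<tau> ** N"
    by (auto simp: N_def matrix_distribs cadj_simps QQ comm)
  have tpm: "\<tau> = p - m"
    by (simp add: p_def m_def N_def matrix_distribs)
  have Qp: "Q ** p = p" "p ** Q = p" "N ** p = 0" "p ** N = 0"
    unfolding p_def by (metis QQ NN comm matrix_mul_assoc times0_left times0_right)+
  have Nm: "N ** m = m" "m ** N = m" "Q ** m = 0" "m ** Q = 0"
    unfolding m_def matrix_minus_left matrix_minus_right
    by (metis QQ NN comm matrix_mul_assoc times0_left times0_right minus_zero)+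
  have p_form: "v \<bullet> (p *v v) = (Q *v v) \<bullet> (\<tau> *v (Q *v v))" for v
    unfolding p_def
    by (metis QQ comm inner_matrix_vector matrix_vector_mul_assoc matrix_mul_assoc)
  have m_form: "v \<bullet> (m *v v) = - ((N *v v) \<bullet> (\<tau> *v (N *v v)))" for v
    unfolding m_def minus_matrix_vector inner_minus_right
    by (metis NN inner_matrix_vector matrix_vector_mul_assoc matrix_mul_assoc)
  have Qv: "0 < (Q *v v) \<bullet> (\<tau> *v (Q *v v))" if "Q *v v \<noteq> 0" for v
    using Q that by (simp add: positive_spectral_proj_def) (metis QQ(1) matrix_vector_mul_assoc)
  have cadj_pm: "cadj p = p" "cadj m = m"
    by (simp_all add: p_def m_def cadj_simps herm QQ NN comm)
  have psdp: "psd p"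
    using cadj_pm Qv unfolding psd_iff p_form
    by (metis inner_zero_left less_eq_real_def)
  then show "psd (\<tau> ** Q)"
    by (simp add: p_def)
  have "Q *v (N *v v) = 0" for v
    by (simp add: matrix_vector_mul_assoc NN)
  then have psdm: "psd m"
    using cadj_pm neg unfolding psd_iff m_form by simp
  \<comment> \<open>\<open>p\<close> kills \<open>cadj Y\<close>, and its form is strictly positive
    at every vector that \<open>Q\<close> does not kill; so \<open>Q\<close> kills
    \<open>cadj Y\<close> as well.\<close>
  have cancel: "Y ** Q = 0" if "Y ** p = 0" for Y :: "'n cmat"
  proof -
    have "cadj (Y ** p) = 0"
      using that by simp
    then have "p ** cadj Y = 0"
      by (simp add: cadj_simps cadj_pm)
    then have "(cadj Y *v v) \<bullet> (p *v (cadj Y *v v)) = 0" for v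
      by (simp add: matrix_vector_mul_assoc)
    then have "Q *v (cadj Y *v v) = 0" for v
      using Qv p_form by (metis less_irrefl)
    then have "Q ** cadj Y = 0"
      by (simp add: matrix_eq_0_iff matrix_vector_mul_assoc)
    then have "cadj (Q ** cadj Y) = 0"
      by simp
    then show ?thesis
      by (simp add: cadj_simps QQ)
  qed
  then show "\<And>Y :: 'n cmat. Y ** (\<tau> ** Q) = 0 \<Longrightarrow> Y ** Q = 0"
    by (simp add: p_def)
  have Dpm: "gksl G I h p = gksl G I h m"
    using stat unfolding tpm by (simp add: linear_diff[OF linear_gksl])
  have Qm': "X ** Q ** m = 0" "X ** m ** Q = 0" "X ** N ** p = 0" "X ** p ** N = 0" for X
    by (simp_all add: matrix_mul_assoc[symmetric] Qp Nm)
  \<comment> \<open>Both compressions below are positive, and since the generator maps p and m to the same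
    traceless matrix their traces add up to 0; so every term vanishes.\<close>
  have compQ: "Q ** gksl G I h m ** Q = (\<Sum>a\<in>I. (Q ** h a) ** m ** cadj (Q ** h a))"
    by (simp add: gksl_def matrix_distribs cadj_simps QQ matrix_mul_assoc Nm Qm')
  have compN: "N ** gksl G I h p ** N = (\<Sum>a\<in>I. (N ** h a) ** p ** cadj (N ** h a))"
    by (simp add: gksl_def matrix_distribs cadj_simps NN matrix_mul_assoc Qp Qm')
  have tr: "trace (Q ** gksl G I h m ** Q + N ** gksl G I h p ** N) = 0"
  proof -
    have compr: "trace (Q ** X ** Q) = trace (Q ** X)" "trace (N ** X ** N) = trace (N ** X)" for X
      by (metis QQ NN trace_mul_sym matrix_mul_assoc)+
    have "Q + N = mat 1"
      by (simp add: N_def)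
    then have "trace (Q ** gksl G I h m ** Q + N ** gksl G I h p ** N) = trace (gksl G I h m)"
      unfolding trace_add compr Dpm
      by (metis matrix_add_rdistrib matrix_mul_lid trace_add)
    then show ?thesis
      by (simp add: trace_gksl[OF cons])
  qed
  have terms: "(Q ** h a) ** m ** cadj (Q ** h a) = 0" "(N ** h a) ** p ** cadj (N ** h a) = 0"
    if "a \<in> I" for a
    using psd_term_trace_zero[OF fin psd_congruence[OF psdm] psd_congruence[OF psdp]
        tr[unfolded compQ compN] that] by simp_all
  have Qhm: "Q ** h a ** m = 0" and Nhp: "N ** h a ** p = 0" if "a \<in> I" for a
    using psd_congruence_eq_0[OF psdm] psd_congruence_eq_0[OF psdp] terms[OF that] by blast+
  show NhQ: "N ** h a ** Q = 0" if "a \<in> I" for a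
    using cancel Nhp that by blast
  have mhQ: "m ** cadj (h a) ** Q = 0" if "a \<in> I" for a
  proof -
    have "cadj (Q ** h a ** m) = 0"
      using Qhm that by simp
    then show ?thesis
      by (simp add: cadj_simps QQ cadj_pm matrix_mul_assoc)
  qed
  \<comment> \<open>The off-diagonal blocks of the images of p and m agree; by conservativity this says
    that X = N G Q satisfies m X + X p = 0 with m, p positive.\<close>
  have crossp: "N ** gksl G I h p ** Q = N ** G ** p"
  proof -
    have "(\<Sum>a\<in>I. N ** h a ** p ** cadj (h a) ** Q) = 0"
      by (intro sum.neutral) (simp add: Nhp)
    then show ?thesis
      by (simp add: gksl_def matrix_distribs matrix_mul_assoc Qp) (simp add: matrix_mul_assoc[symmetric] Qp)
  qed
  have crossm: "N ** gksl G I h m ** Q = m ** cadj G ** Q"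
  proof -
    have "N ** h a ** m ** cadj (h a) ** Q = 0" if "a \<in> I" for a
      using mhQ[OF that] by (simp add: matrix_mul_assoc[symmetric])
    then have "(\<Sum>a\<in>I. N ** h a ** m ** cadj (h a) ** Q) = 0"
      by (intro sum.neutral) blast
    then show ?thesis
      by (simp add: gksl_def matrix_distribs matrix_mul_assoc Nm) (simp add: matrix_mul_assoc[symmetric] Nm)
  qed
  define X where "X = N ** G ** Q"
  \<comment> \<open>By \<open>NhQ\<close> a further \<open>Q\<close> fits between
    \<open>cadj (h a)\<close> and \<open>h a\<close>, and \<open>mhQ\<close> applies; thus the jump
    part drops out when conservativity is compressed between \<open>m\<close> and
    \<open>Q\<close>.\<close>
  have mhhQ: "m ** (cadj (h a) ** h a) ** Q = 0" if "a \<in> I" for a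
  proof -
    have "h a ** Q = Q ** h a ** Q"
      using NhQ[OF that] by (simp add: N_def matrix_distribs)
    then have "m ** (cadj (h a) ** h a) ** Q = (m ** cadj (h a) ** Q) ** h a ** Q"
      by (metis matrix_mul_assoc)
    then show ?thesis
      by (simp add: mhQ that)
  qed
  have "m ** (G + cadj G + (\<Sum>a\<in>I. cadj (h a) ** h a)) ** Q = 0"
    using cons by (simp add: conservative_def)
  then have "m ** G ** Q + m ** cadj G ** Q = 0"
    by (simp add: matrix_distribs mhhQ sum.neutral)
  moreover have "m ** cadj G ** Q = N ** G ** p"
    using crossp crossm Dpm by simp
  moreover have "m ** G ** Q = m ** X"
    by (simp add: X_def matrix_mul_assoc Nm)
  moreover have "N ** G ** p = X ** p"
    by (simp add: X_def matrix_mul_assoc[symmetric] Qp)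
  ultimately have "m ** X + X ** p = 0"
    by simp
  \<comment> \<open>The factor \<open>cadj X\<close> turns both summands, under the trace, into
    traces of congruences of \<open>m\<close> and \<open>p\<close>, which cannot cancel.\<close>
  then have "(m ** X + X ** p) ** cadj X = 0"
    by simp
  then have "m ** X ** cadj X + X ** p ** cadj X = 0"
    by (simp add: matrix_distribs)
  then have "trace (m ** X ** cadj X) + trace (X ** p ** cadj X) = 0"
    by (metis trace_add trace_0 mat_0)
  moreover have "trace (m ** X ** cadj X) = trace (cadj X ** m ** cadj (cadj X))"
    by (simp add: trace_mul_sym[of "cadj X ** m"] trace_mul_sym[of "m ** X"] matrix_mul_assoc)
  ultimately have "Re (trace (cadj X ** m ** cadj (cadj X))) + Re (trace (X ** p ** cadj X)) = 0"
    by (metis plus_complex.simps(1) zero_complex.simps(1))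
  moreover note psd_congruence[OF psdm, of "cadj X"] psd_congruence[OF psdp, of X]
  ultimately have "X ** p ** cadj X = 0"
    by (intro psd_trace_eq_0) (auto dest!: psd_trace_nonneg)
  then have "X ** Q = 0"
    by (intro cancel psd_congruence_eq_0[OF psdp])
  then show "N ** G ** Q = 0"
    by (simp add: X_def matrix_mul_assoc[symmetric] QQ)
qed


section \<open>Collecting projectors\<close>

lemma summable_semigroup:
  fixes D :: "'n::finite cmat \<Rightarrow> 'n cmat"
  assumes "linear D"
  shows "summable (\<lambda>k. (t ^ k / fact k) *\<^sub>R (D ^^ k) x)"
proof -
  obtain B where B: "B > 0" "\<And>x. norm (D x) \<le> B * norm x"
    using linear_bounded_pos[OF assms] by blast
  have le: "norm ((D ^^ k) x) \<le> B ^ k * norm x" for k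
  proof (induction k)
    case (Suc k)
    have "norm ((D ^^ Suc k) x) \<le> B * norm ((D ^^ k) x)"
      using B by simp
    also have "\<dots> \<le> B * (B ^ k * norm x)"
      using Suc B by (intro mult_left_mono) auto
    finally show ?case
      by (simp add: mult.assoc)
  qed simp
  show ?thesis
  proof (rule summable_comparison_test')
    show "summable (\<lambda>k. ((\<bar>t\<bar> * B) ^ k /\<^sub>R fact k) * norm x)"
      by (intro summable_mult2 summable_exp_generic)
    show "norm ((t ^ k / fact k) *\<^sub>R (D ^^ k) x) \<le> ((\<bar>t\<bar> * B) ^ k /\<^sub>R fact k) * norm x" for k
      using mult_left_mono[OF le[of k], of "\<bar>t\<bar> ^ k / fact k"]
      by (simp add: power_mult_distrib power_abs field_simps)
  qed
qed

lemma semigroup_annihilated: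
  fixes D :: "'n::finite cmat \<Rightarrow> 'n cmat" and K :: "'n cmat \<Rightarrow> 'n cmat"
  assumes "linear D" "linear K" "\<And>k. K ((D ^^ k) x) = 0"
  shows "K (semigroup D t x) = 0"
proof -
  have "bounded_linear K"
    using assms(2) by (simp add: linear_conv_bounded_linear)
  then have "K (semigroup D t x) = (\<Sum>k. K ((t ^ k / fact k) *\<^sub>R (D ^^ k) x))"
    unfolding semigroup_def by (intro bounded_linear.suminf summable_semigroup assms(1))
  then show ?thesis
    by (simp add: linear_scale[OF assms(2)] assms(3))
qed

text \<open>This takes the derivative at 0 from the right. Pairing with \<open>K (D x)\<close>
  itself reduces it to a scalar power series in t with constant term 0 and linear coefficient the
  squared norm of \<open>K (D x)\<close>; the series vanishes for t > 0.\<close>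

lemma generator_annihilated:
  fixes D :: "'n::finite cmat \<Rightarrow> 'n cmat" and K :: "'n cmat \<Rightarrow> 'n cmat"
  assumes D: "linear D" and K: "linear K"
    and sg: "\<And>t. t > 0 \<Longrightarrow> K (semigroup D t x) = 0" and Kx: "K x = 0"
  shows "K (D x) = 0"
proof -
  define u where "u = K (D x)"
  define L where "L = (\<lambda>y. K y \<bullet> u)"
  define a where "a = (\<lambda>k. L ((D ^^ k) x) / fact k)"
  have bl: "bounded_linear L"
    unfolding L_def using K
    by (intro bounded_linear_compose[OF bounded_linear_inner_left])
      (simp add: linear_conv_bounded_linear)
  have sums: "(\<lambda>k. a k * t ^ k) sums L (semigroup D t x)" for t
  proof -
    have "(\<lambda>k. L ((t ^ k / fact k) *\<^sub>R (D ^^ k) x)) sums L (semigroup D t x)"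
      unfolding semigroup_def
      by (intro bounded_linear.sums[OF bl] summable_sums summable_semigroup D)
    then show ?thesis
      by (simp add: a_def linear_scale[OF bounded_linear.linear[OF bl]] field_simps)
  qed
  have a0: "a 0 = 0"
    by (simp add: a_def L_def Kx)
  \<comment> \<open>The value at 0 is that of the series divided by t, so that one power series
    represents \<open>g\<close> at every t.\<close>
  define g where "g = (\<lambda>t. if t = 0 then a 1 else L (semigroup D t x) / t)"
  have g: "(\<lambda>k. a (Suc k) * t ^ k) sums g t" for t
  proof (cases "t = 0")
    case True
    then show ?thesis
      using powser_sums_zero[of "\<lambda>k. a (Suc k)"] by (simp add: g_def)
  next
    case False
    have "(\<lambda>k. a (Suc k) * t ^ Suc k) sums L (semigroup D t x)"
      using sums[of t] a0 sums_Suc_iff[of "\<lambda>k. a k * t ^ k"] by simp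
    then have "(\<lambda>k. a (Suc k) * t ^ Suc k / t) sums (L (semigroup D t x) / t)"
      by (rule sums_divide)
    then show ?thesis
      using False by (simp add: g_def)
  qed
  have "(g \<longlongrightarrow> a (Suc 0)) (at 0)"
    using powser_limit_0[of 1 "\<lambda>k. a (Suc k)" g] g by simp
  then have "(g \<longlongrightarrow> a (Suc 0)) (at_right 0)"
    by (rule filterlim_mono) (auto simp: at_le)
  moreover have "(g \<longlongrightarrow> 0) (at_right 0)"
  proof (rule tendsto_eventually)
    show "\<forall>\<^sub>F t in at_right 0. g t = 0"
      using eventually_at_right_less[of "0::real"]
      by eventually_elim (simp add: g_def L_def sg)
  qed
  ultimately have "a (Suc 0) = 0"
    using tendsto_unique[OF trivial_limit_at_right_real] by blast
  then show ?thesis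
    by (simp add: a_def L_def u_def)
qed

lemma linear_off_corner: "linear (\<lambda>X. X - P ** X ** P)" for P :: "'n::finite cmat"
  by (intro linearI) (simp_all add: matrix_distribs scaleR_diff_right)

text \<open>Both directions use the map X - P X P, whose kernel is the corner: differentiation at 0
  gives one, and iterating the generator inside the power series gives the other.\<close>

lemma collecting_iff_corner_invariant:
  assumes "linear (lindblad H I h)"
  shows "collecting H I h P \<longleftrightarrow> orth_proj P \<and>
    (\<forall>X. lindblad H I h (P ** X ** P) = P ** lindblad H I h (P ** X ** P) ** P)"
proof (cases "orth_proj P")
  case True
  then have PP: "P ** P = P"
    by (rule orth_projD)
  define D where "D = lindblad H I h"
  note D = assms[folded D_def]
  have corner: "P ** (P ** X ** P) ** P = P ** X ** P" for X
    by (metis PP matrix_mul_assoc)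
  have "D (P ** X ** P) - P ** D (P ** X ** P) ** P = 0"
    if "\<forall>t>0. \<forall>\<sigma>. semigroup D t (P ** \<sigma> ** P) = P ** semigroup D t (P ** \<sigma> ** P) ** P" for X
    using that by (intro generator_annihilated[OF D linear_off_corner]) (auto simp: corner)
  moreover have "semigroup D t (P ** X ** P) - P ** semigroup D t (P ** X ** P) ** P = 0"
    if inv: "\<forall>X. D (P ** X ** P) = P ** D (P ** X ** P) ** P" for t X
  proof (rule semigroup_annihilated[OF D linear_off_corner])
    have "(D ^^ k) (P ** X ** P) = P ** (D ^^ k) (P ** X ** P) ** P" for k
    proof (induction k)
      case (Suc k)
      then show ?case
        using inv by (metis comp_apply funpow.simps(2))
    qed (simp add: corner)
    then show "(D ^^ k) (P ** X ** P) - P ** (D ^^ k) (P ** X ** P) ** P = 0" for k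
      by simp
  qed
  ultimately show ?thesis
    using True unfolding collecting_def D_def[symmetric] by auto
qed (simp add: collecting_def)

text \<open>The hypotheses say that \<open>Q\<close> may be inserted to the left of
  \<open>h a ** Q\<close> and \<open>G ** Q\<close>; their adjoints handle the right-hand factors,
  so each term of \<open>gksl\<close> separately stays in the corner.\<close>

lemma corner_invariantI:
  assumes Q: "orth_proj Q"
    and h: "\<And>a. a \<in> I \<Longrightarrow> (mat 1 - Q) ** h a ** Q = 0" and G: "(mat 1 - Q) ** G ** Q = 0"
  shows "gksl G I h (Q ** X ** Q) = Q ** gksl G I h (Q ** X ** Q) ** Q"
proof -
  have left: "A ** Q = Q ** A ** Q" if "(mat 1 - Q) ** A ** Q = 0" for A
    using that by (simp add: matrix_distribs)
  have right: "Q ** cadj A = Q ** cadj A ** Q" if "(mat 1 - Q) ** A ** Q = 0" for A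
  proof -
    have "cadj (A ** Q) = cadj (Q ** A ** Q)"
      using left[OF that] by simp
    then show ?thesis
      by (simp add: cadj_simps orth_projD[OF Q] matrix_mul_assoc)
  qed
  note QQ = orth_projD(1)[OF Q]
  have 1: "G ** (Q ** X ** Q) = Q ** (G ** (Q ** X ** Q)) ** Q"
    by (metis left[OF G] QQ matrix_mul_assoc)
  have 2: "(Q ** X ** Q) ** cadj G = Q ** ((Q ** X ** Q) ** cadj G) ** Q"
    by (metis right[OF G] QQ matrix_mul_assoc)
  have 3: "h a ** (Q ** X ** Q) ** cadj (h a) = Q ** (h a ** (Q ** X ** Q) ** cadj (h a)) ** Q"
    if "a \<in> I" for a
    by (metis left[OF h[OF that]] right[OF h[OF that]] QQ matrix_mul_assoc)
  then have "(\<Sum>a\<in>I. h a ** (Q ** X ** Q) ** cadj (h a))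
      = Q ** (\<Sum>a\<in>I. h a ** (Q ** X ** Q) ** cadj (h a)) ** Q"
    unfolding matrix_sum_left matrix_sum_right by (rule sum.cong[OF refl])
  with 1 2 show ?thesis
    unfolding gksl_def matrix_add_ldistrib matrix_add_rdistrib by metis
qed

text \<open>Each projector fixes the common range, so Q P = P and P Q = Q, and these products are
  adjoint to each other. It translates minimality, stated for ranges, into equality of
  projectors.\<close>

lemma orth_proj_rng_inject:
  assumes "orth_proj P" "orth_proj Q" "rng P = rng Q"
  shows "P = Q"
proof -
  have "Q ** P = P"
    using assms(1,2) rng_orth_proj[OF assms(2)] assms(3) unfolding matrix_eq
    by (metis matrix_vector_mul_assoc rangeI rng_def)
  moreover have "P ** Q = Q"
    using assms(1,2) rng_orth_proj[OF assms(1)] assms(3) unfolding matrix_eq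
    by (metis matrix_vector_mul_assoc rangeI rng_def)
  ultimately show ?thesis
    using assms by (metis cadj_mult orth_projD(2))
qed

section \<open>Stationary matrices on a minimal collecting subspace\<close>

lemma exists_stationary_hermitian:
  assumes cons: "conservative G I h" and P: "orth_proj P" "P \<noteq> 0"
    and inv: "\<And>X. gksl G I h (P ** X ** P) = P ** gksl G I h (P ** X ** P) ** P"
  obtains \<tau> where "cadj \<tau> = \<tau>" "\<tau> \<noteq> 0" "\<tau> = P ** \<tau> ** P" "gksl G I h \<tau> = 0"
proof -
  note PP = orth_projD[OF P(1)]
  \<comment> \<open>On the corner F is the generator, whose image there has trace 0 and so misses P;
    as F leaves the off-corner part of X unchanged, a preimage of P would lie in the corner.\<close>
  define F where "F X = gksl G I h (P ** X ** P) + (X - P ** X ** P)" for X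
  have "linear F"
    unfolding F_def
    by (intro linear_compose_add linear_off_corner linear_compose[OF _ linear_gksl, unfolded o_def] linearI)
      (simp_all add: matrix_distribs)
  have corner: "P ** (P ** X ** P) ** P = P ** X ** P" for X
    by (metis PP(1) matrix_mul_assoc)
  have off: "F X - P ** F X ** P = X - P ** X ** P" for X
    using inv[of X] by (simp add: F_def matrix_distribs corner algebra_simps)
  have "\<not> surj F"
  proof
    assume "surj F"
    then obtain X where X: "F X = P"
      by (metis surjD)
    then have "X = P ** X ** P"
      using off[of X] by (simp add: PP)
    then have "gksl G I h (P ** X ** P) = P"
      using X by (simp add: F_def)
    then have "trace P = 0"
      using trace_gksl[OF cons] by metis
    then have "P \<bullet> P = 0"
      using trace_cadj_mult_self[of P] by (simp add: PP)
    then show False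
      using P by simp
  qed
  then have "\<not> inj F"
    using linear_injective_imp_surjective[OF \<open>linear F\<close>] by blast
  then obtain X where X: "F X = 0" "X \<noteq> 0"
    using linear_injective_0[OF \<open>linear F\<close>] by blast
  then have XP: "X = P ** X ** P"
    using off[of X] by simp
  then have stat: "gksl G I h X = 0"
    using X by (simp add: F_def)
  have "cadj X = cadj (P ** X ** P)"
    using XP by simp
  then have XP': "cadj X = P ** cadj X ** P"
    by (simp add: cadj_simps PP matrix_mul_assoc)
  have stat': "gksl G I h (cadj X) = 0"
    using stat by (simp flip: cadj_gksl)
  \<comment> \<open>The kernel is closed under adjoints, so the Hermitian part of \<open>X\<close>
    qualifies unless it is 0; then \<open>X\<close> is anti-Hermitian and i times \<open>X\<close>
    is Hermitian.\<close>
  show thesis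
  proof (cases "X + cadj X = 0")
    case False
    show thesis
    proof (rule that[OF _ False])
      show "X + cadj X = P ** (X + cadj X) ** P"
        unfolding matrix_add_ldistrib matrix_add_rdistrib using XP XP' by metis
    qed (simp_all add: cadj_simps gksl_add stat stat' add.commute)
  next
    case True
    then have "cadj X = - X"
      by (simp add: eq_neg_iff_add_eq_0 add.commute)
    show thesis
    proof (rule that[of "csmult \<i> X"])
      show "cadj (csmult \<i> X) = csmult \<i> X"
        by (simp add: cadj_simps \<open>cadj X = - X\<close>) (simp add: csmult_def vec_eq_iff)
      show "csmult \<i> X \<noteq> 0"
        using X by (auto simp: csmult_def vec_eq_iff)
      show "csmult \<i> X = P ** csmult \<i> X ** P"
        unfolding csmult_left csmult_right using XP by metis
      show "gksl G I h (csmult \<i> X) = 0"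
        by (simp add: gksl_csmult stat) (simp add: csmult_def vec_eq_iff)
    qed
  qed
qed

text \<open>Cancellation applied to \<open>mat 1 - P\<close> places the support \<open>Q\<close> of
  the positive part inside \<open>P\<close>; the vector \<open>v\<close> excludes
  \<open>Q = 0\<close>. Once \<open>Q = P\<close>, the matrix \<tau> coincides with its positive
  part \<open>\<tau> ** Q\<close>.\<close>

lemma positive_support_full:
  fixes P \<tau> :: "'n::finite cmat"
  assumes fin: "finite I" and cons: "conservative G I h"
    and P: "orth_proj P"
    and min: "\<And>Q. orth_proj Q \<Longrightarrow> Q \<noteq> 0 \<Longrightarrow> rng Q \<subseteq> rng P \<Longrightarrow>
      (\<And>X. gksl G I h (Q ** X ** Q) = Q ** gksl G I h (Q ** X ** Q) ** Q) \<Longrightarrow> Q = P"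
    and \<tau>: "cadj \<tau> = \<tau>" "\<tau> = P ** \<tau> ** P" "gksl G I h \<tau> = 0"
    and v: "0 < v \<bullet> (\<tau> *v v)"
  shows "psd \<tau>" and "\<And>Y :: 'n cmat. Y ** \<tau> = 0 \<Longrightarrow> Y ** P = 0"
proof -
  obtain Q where Q: "positive_spectral_proj \<tau> Q" and neg: "\<And>v. Q *v v = 0 \<Longrightarrow> v \<bullet> (\<tau> *v v) \<le> 0"
    using spectral_split[OF \<tau>(1)] by blast
  note supp = positive_support_invariant[OF fin cons \<tau>(1,3) Q neg]
  note PP = orth_projD(1)[OF P]
  have orthQ: "orth_proj Q"
    using Q by (simp add: positive_spectral_proj_def)
  have "Q \<noteq> 0"
    using neg[of v] v by auto
  have "P ** \<tau> = \<tau>" "\<tau> ** P = \<tau>"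
    using \<tau>(2) PP by (metis matrix_mul_assoc)+
  then have "(mat 1 - P) ** (\<tau> ** Q) = 0"
    by (simp add: matrix_distribs matrix_mul_assoc)
  then have "P ** Q = Q"
    using supp(4)[of "mat 1 - P"] by (simp add: matrix_distribs)
  then have "rng Q \<subseteq> rng P"
    unfolding rng_def by (metis image_subsetI matrix_vector_mul_assoc rangeI)
  then have "Q = P"
    using supp(1,2) by (intro min corner_invariantI orthQ \<open>Q \<noteq> 0\<close>) auto
  then show "psd \<tau>" "\<And>Y :: 'n cmat. Y ** \<tau> = 0 \<Longrightarrow> Y ** P = 0"
    using supp(3,4) \<open>\<tau> ** P = \<tau>\<close> by simp_all
qed

lemma hermitian_form_nonzero:
  fixes \<tau> :: "'n::finite cmat"
  assumes "cadj \<tau> = \<tau>" "\<tau> \<noteq> 0"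
  obtains v where "v \<bullet> (\<tau> *v v) \<noteq> 0"
proof (rule ccontr)
  assume "\<not> thesis"
  then have zero: "v \<bullet> (\<tau> *v v) = 0" for v
    using that by blast
  then have "psd \<tau>"
    using assms by (simp add: psd_iff)
  then have "\<tau> *v v = 0" for v
    using zero by (rule psd_null_vector)
  then show False
    using assms by (simp add: matrix_eq_0_iff)
qed

text \<open>Conjugation is only conjugate-linear, so the conjugated basis is shown to span directly.
  One inequality is enough, since conjugation is an involution.\<close>

lemma vec_dim_cnj_le:
  fixes S :: "(complex^'n::finite) set"
  shows "vec.dim ((\<lambda>v. \<chi> i. cnj (v $ i)) ` S) \<le> vec.dim S"
proof -
  let ?c = "\<lambda>v :: complex^'n. \<chi> i. cnj (v $ i)"
  obtain B where B: "B \<subseteq> S" "vec.independent B" "S \<subseteq> vec.span B" "card B = vec.dim S"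
    using vec.basis_exists by blast
  have finB: "finite B"
    using B vec.independent_bound_general by (metis vec.finiteI_independent)
  have "?c v \<in> vec.span (?c ` B)" if "v \<in> vec.span B" for v
    using that
  proof (induction rule: vec.span_induct_alt)
    case base
    have "?c 0 = 0"
      by (simp add: vec_eq_iff)
    then show ?case
      by (simp only: vec.span_zero)
  next
    case (step c x y)
    have "?c (c *s x + y) = cnj c *s ?c x + ?c y"
      by (simp add: vec_eq_iff)
    then show ?case
      using step by (metis vec.span_add vec.span_scale vec.span_base imageI)
  qed
  then have "?c ` S \<subseteq> vec.span (?c ` B)"
    using B by blast
  then have "vec.dim (?c ` S) \<le> card (?c ` B)"
    using finB by (intro vec.dim_le_card) auto
  also have "\<dots> \<le> vec.dim S"
    using card_image_le[OF finB] B by simp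
  finally show ?thesis .
qed

text \<open>The library's rank over a general field is the row rank, and it equates row and column
  rank only over the reals. The rows of a Hermitian matrix are the conjugates of its columns.\<close>
lemma rank_hermitian:
  assumes "cadj \<rho> = \<rho>"
  shows "rank \<rho> = vec.dim (rng \<rho>)"
proof -
  let ?c = "\<lambda>v :: complex^'n. \<chi> i. cnj (v $ i)"
  have entry: "\<rho> $ i $ j = cnj (\<rho> $ j $ i)" for i j
    using assms by (metis (no_types, lifting) cadj_def vec_lambda_beta)
  have row: "row i \<rho> = ?c (column i \<rho>)" and col: "column i \<rho> = ?c (row i \<rho>)" for i
    by (simp_all add: vec_eq_iff row_def column_def flip: entry)
  have "rows \<rho> = ?c ` columns \<rho>"
    by (auto simp: rows_def columns_def row)
  moreover have "columns \<rho> = ?c ` rows \<rho>"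
    by (auto simp: rows_def columns_def col)
  ultimately have "vec.dim (rows \<rho>) = vec.dim (columns \<rho>)"
    using vec_dim_cnj_le by (metis le_antisym)
  moreover have "vec.dim (columns \<rho>) = vec.dim (rng \<rho>)"
  proof -
    have "column i \<rho> \<in> rng \<rho>" for i
      unfolding rng_def by (rule range_eqI[of _ _ "axis i 1"])
        (simp add: vec_eq_iff matrix_vector_axis column_def)
    then have "columns \<rho> \<subseteq> vec.span (rng \<rho>)"
      by (auto simp: columns_def intro!: vec.span_base)
    moreover have "rng \<rho> \<subseteq> vec.span (columns \<rho>)"
      by (auto simp: rng_def intro: matrix_vector_mult_in_columnspace_gen)
    ultimately have "vec.span (columns \<rho>) = vec.span (rng \<rho>)"
      by (simp add: vec.span_eq)
    then show ?thesis
      by (metis vec.dim_span)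
  qed
  ultimately show ?thesis
    by (simp add: row_rank_def_gen)
qed

text \<open>Adding the identity on the complement of \<open>P\<close> makes \<tau> invertible;
  surjectivity of the sum, compressed by \<open>P\<close>, gives the nontrivial inclusion.\<close>

lemma rng_eq_of_faithful:
  fixes P \<tau> :: "'n::finite cmat"
  assumes P: "orth_proj P" and \<tau>: "cadj \<tau> = \<tau>" "\<tau> = P ** \<tau> ** P"
    and faithful: "\<And>Y :: 'n cmat. Y ** \<tau> = 0 \<Longrightarrow> Y ** P = 0"
  shows "rng \<tau> = rng P"
proof
  have Pt: "P ** \<tau> = \<tau>" "\<tau> ** P = \<tau>"
    using \<tau>(2) orth_projD(1)[OF P] by (metis matrix_mul_assoc)+
  show "rng \<tau> \<subseteq> rng P"
    unfolding rng_def by (metis Pt(1) image_subsetI matrix_vector_mul_assoc rangeI)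
  have "inj ((*v) (\<tau> + (mat 1 - P)))"
  proof (subst linear_injective_0, simp, intro allI impI)
    fix x assume x: "(\<tau> + (mat 1 - P)) *v x = 0"
    have "P ** (\<tau> + (mat 1 - P)) = \<tau>"
      by (simp add: matrix_distribs Pt orth_projD[OF P])
    then have tx: "\<tau> *v x = 0"
      using x by (metis matrix_vector_mul_assoc matrix_vector_mult_0_right)
    then have "x = P *v x"
      using x by (simp add: matrix_vector_mult_add_rdistrib matrix_vector_mult_diff_rdistrib)
    \<comment> \<open>Cancellation speaks of matrices, so the vector \<open>x\<close> enters through
      the rank-one matrix \<open>outer x\<close>.\<close>
    have "\<tau> ** outer x = 0"
      by (simp add: matrix_outer tx vec_eq_iff)
    then have "cadj (\<tau> ** outer x) = 0"
      by simp
    then have "outer x ** P = 0"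
      by (intro faithful) (simp add: cadj_simps \<tau>(1))
    then have "cadj (outer x ** P) = 0"
      by simp
    then have "P ** outer x = 0"
      by (simp add: cadj_simps orth_projD[OF P])
    then have "x $ i * cnj (x $ i) = 0" for i
      using \<open>x = P *v x\<close> by (simp add: matrix_outer vec_eq_iff)
    then show "x = 0"
      by (simp add: vec_eq_iff)
  qed
  then have "surj ((*v) (\<tau> + (mat 1 - P)))"
    by (intro linear_injective_imp_surjective) auto
  show "rng P \<subseteq> rng \<tau>"
  proof
    fix v assume "v \<in> rng P"
    then have "P *v v = v"
      using rng_orth_proj[OF P] by blast
    obtain x where "v = (\<tau> + (mat 1 - P)) *v x"
      using \<open>surj _\<close> by (metis surjD)
    then have "v = (P ** (\<tau> + (mat 1 - P))) *v x"
      by (metis \<open>P *v v = v\<close> matrix_vector_mul_assoc)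
    also have "P ** (\<tau> + (mat 1 - P)) = \<tau>"
      by (simp add: matrix_distribs Pt orth_projD[OF P])
    finally show "v \<in> rng \<tau>"
      by (simp add: rng_def)
  qed
qed

theorem mainTheorem9:
  fixes H :: "complex^'n::finite^'n" and I :: "'a set" and h :: "'a \<Rightarrow> complex^'n^'n"
    and P :: "complex^'n^'n"
  assumes "finite I"
    and "cadj H = H"
    and "collecting H I h P"
    and "P \<noteq> 0"
    and "\<not> (\<exists>Q. collecting H I h Q \<and> Q \<noteq> 0 \<and> rng Q \<subseteq> rng P \<and> rng Q \<noteq> rng P)"
  shows "\<exists>\<rho>. (density \<rho> \<and> \<rho> = P ** \<rho> ** P \<and> lindblad H I h \<rho> = 0)
            \<and> (\<forall>\<sigma>. density \<sigma> \<and> \<sigma> = P ** \<sigma> ** P \<and> lindblad H I h \<sigma> = 0 \<longrightarrow> \<sigma> = \<rho>)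
            \<and> rank \<rho> = vec.dim (rng P)"
proof -
  define G where "G = drift H I h"
  have lind: "lindblad H I h = gksl G I h"
    by (simp add: lindblad_eq_gksl assms G_def)
  have cons: "conservative G I h"
    by (simp add: conservative_drift assms G_def)
  note coll = collecting_iff_corner_invariant[of H I h, unfolded lind, OF linear_gksl]
  have P: "orth_proj P"
    and inv: "\<And>X. gksl G I h (P ** X ** P) = P ** gksl G I h (P ** X ** P) ** P"
    using assms(3) by (auto simp: coll)
  have min: "Q = P" if "orth_proj Q" "Q \<noteq> 0" "rng Q \<subseteq> rng P"
    "\<And>X. gksl G I h (Q ** X ** Q) = Q ** gksl G I h (Q ** X ** Q) ** Q" for Q
  proof (rule orth_proj_rng_inject[OF that(1) P])
    have "collecting H I h Q"
      using that by (auto simp: coll)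
    then show "rng Q = rng P"
      using assms(5) that by blast
  qed
  have definite: "\<exists>s::real. psd (s *\<^sub>R \<tau>) \<and> s \<noteq> 0 \<and> (\<forall>Y :: 'n cmat. Y ** (s *\<^sub>R \<tau>) = 0 \<longrightarrow> Y ** P = 0)"
    if \<tau>: "cadj \<tau> = \<tau>" "\<tau> \<noteq> 0" "\<tau> = P ** \<tau> ** P" "gksl G I h \<tau> = 0" for \<tau>
  proof -
    obtain v where v: "v \<bullet> (\<tau> *v v) \<noteq> 0"
      using hermitian_form_nonzero \<tau> by blast
    \<comment> \<open>This sign makes the form of \<open>s *\<^sub>R \<tau>\<close> positive at
      \<open>v\<close>, so one argument covers \<tau> and its negative.\<close>
    define s where "s = sgn (v \<bullet> (\<tau> *v v))"
    have herm: "cadj (s *\<^sub>R \<tau>) = s *\<^sub>R \<tau>" and stat: "gksl G I h (s *\<^sub>R \<tau>) = 0"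
      by (simp_all add: cadj_scaleR gksl_scaleR \<tau>(1,4))
    have corner: "s *\<^sub>R \<tau> = P ** (s *\<^sub>R \<tau>) ** P"
      unfolding matrix_scaleR_left matrix_scaleR_right using \<tau>(3) by metis
    have pos: "0 < v \<bullet> ((s *\<^sub>R \<tau>) *v v)"
      using v by (cases "0 < v \<bullet> (\<tau> *v v)") (simp_all add: s_def scaleR_matrix_vector minus_matrix_vector sgn_if)
    have "psd (s *\<^sub>R \<tau>)"
      by (rule positive_support_full(1)[OF \<open>finite I\<close> cons P _ herm corner stat pos]) (fact min)
    moreover have "Y ** P = 0" if "Y ** (s *\<^sub>R \<tau>) = 0" for Y :: "'n cmat"
      by (rule positive_support_full(2)[OF \<open>finite I\<close> cons P _ herm corner stat pos that]) (fact min)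
    moreover have "s \<noteq> 0"
      using v by (simp add: s_def sgn_zero_iff)
    ultimately show ?thesis
      by blast
  qed
  \<comment> \<open>A nonzero \<tau> would be semidefinite up to sign, and a semidefinite matrix of
    trace 0 is 0; this is the source of uniqueness.\<close>
  have trace0: "\<tau> = 0"
    if \<tau>: "cadj \<tau> = \<tau>" "\<tau> = P ** \<tau> ** P" "gksl G I h \<tau> = 0" "trace \<tau> = 0" for \<tau>
  proof (rule ccontr)
    assume "\<tau> \<noteq> 0"
    then obtain s :: real where "psd (s *\<^sub>R \<tau>)" "s \<noteq> 0"
      using definite[OF \<tau>(1) _ \<tau>(2,3)] by blast
    moreover have "Re (trace (s *\<^sub>R \<tau>)) = 0"
      by (simp add: trace_scaleR \<tau>(4))
    ultimately show False
      using psd_trace_eq_0[of "s *\<^sub>R \<tau>"] \<open>\<tau> \<noteq> 0\<close> by simp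
  qed
  obtain \<tau>0 where \<tau>0: "cadj \<tau>0 = \<tau>0" "\<tau>0 \<noteq> 0" "\<tau>0 = P ** \<tau>0 ** P" "gksl G I h \<tau>0 = 0"
    using exists_stationary_hermitian[OF cons P \<open>P \<noteq> 0\<close> inv] by metis
  obtain s :: real where s: "psd (s *\<^sub>R \<tau>0)" "s \<noteq> 0"
    "\<And>Y :: 'n cmat. Y ** (s *\<^sub>R \<tau>0) = 0 \<Longrightarrow> Y ** P = 0"
    using definite[OF \<tau>0] by blast
  define c where "c = Re (trace (s *\<^sub>R \<tau>0))"
  have "c > 0"
    using psd_trace_nonneg[OF s(1)] psd_trace_eq_0[OF s(1)] s(2) \<tau>0(2)
    by (auto simp: c_def less_le)
  \<comment> \<open>Here \<open>s\<close> corrects the sign of \<open>\<tau>0\<close> and the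
    positive number \<open>c\<close> normalises the trace.\<close>
  define \<rho> where "\<rho> = (s / c) *\<^sub>R \<tau>0"
  have herm: "cadj \<rho> = \<rho>"
    by (simp add: \<rho>_def cadj_scaleR \<tau>0(1))
  have "psd \<rho>"
  proof -
    have "v \<bullet> (\<rho> *v v) = (v \<bullet> ((s *\<^sub>R \<tau>0) *v v)) / c" for v
      by (simp add: \<rho>_def scaleR_matrix_vector)
    then show ?thesis
      using herm s(1) \<open>c > 0\<close> by (simp add: psd_iff)
  qed
  moreover have tr: "trace \<rho> = 1"
  proof -
    have "Re (trace \<rho>) = 1"
      using \<open>c > 0\<close> by (auto simp: \<rho>_def c_def trace_scaleR zero_less_mult_iff)
    then show ?thesis
      using trace_hermitian[OF herm] by simp
  qed
  ultimately have dens: "density \<rho>"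
    by (simp add: density_def)
  have corner: "\<rho> = P ** \<rho> ** P"
    unfolding \<rho>_def matrix_scaleR_left matrix_scaleR_right using \<tau>0(3) by metis
  have stat: "gksl G I h \<rho> = 0"
    by (simp add: \<rho>_def gksl_scaleR \<tau>0(4))
  have unique: "\<sigma> = \<rho>" if \<sigma>: "density \<sigma>" "\<sigma> = P ** \<sigma> ** P" "gksl G I h \<sigma> = 0" for \<sigma>
  proof -
    have "\<sigma> - \<rho> = 0"
    proof (rule trace0)
      show "cadj (\<sigma> - \<rho>) = \<sigma> - \<rho>"
        using \<sigma>(1) by (simp add: cadj_diff herm density_def psd_iff)
      show "\<sigma> - \<rho> = P ** (\<sigma> - \<rho>) ** P"
        by (simp only: matrix_diff_ldistrib matrix_diff_rdistrib flip: \<sigma>(2) corner)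
      show "gksl G I h (\<sigma> - \<rho>) = 0"
        by (simp add: linear_diff[OF linear_gksl] \<sigma>(3) stat)
      show "trace (\<sigma> - \<rho>) = 0"
        using \<sigma>(1) tr by (simp add: trace_sub density_def)
    qed
    then show ?thesis
      by simp
  qed
  have rank: "rank \<rho> = vec.dim (rng P)"
  proof -
    have "Y ** P = 0" if "Y ** \<rho> = 0" for Y :: "'n cmat"
      using that s \<open>c > 0\<close> by (simp add: \<rho>_def matrix_scaleR_right)
    then show ?thesis
      using rng_eq_of_faithful[OF P herm corner] by (simp add: rank_hermitian[OF herm])
  qed
  show ?thesis
    unfolding lind using dens corner stat rank by (intro exI[of _ \<rho>] conjI allI impI unique) simp_all
qed

end
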